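(* Let $n\ge3$ and let $\tau:\mathbb M_n(\mathbb C)\to\mathbb M_n(\mathbb C)$ be any map such that $\tau(TDT^{-1})=T\overline DT^{-1}$ for every diagonal $D\in\mathbb M_n(\mathbb C)$ and every invertible $T\in\mathbb M_n(\mathbb C)$ (with arbitrary values at non-diagonalizable matrices). Then $\tau$ is unbounded, i.e. $\sup\{\|\tau(A)\|: A\in\mathbb M_n(\mathbb C),\ \|A\|\le1\}=\infty$.
   Context: $\mathbb M_n(\mathbb C)$ is the set of complex $n\times n$ matrices, $\overline D$ is the entrywise complex conjugate of the diagonal matrix $D$, and $\|\cdot\|$ is the operator norm induced by the Euclidean norm. *)

theory Defs
  imports "HOL-Analysis.Analysis"
begin

definition diagonal_mat :: "complex ^ 'n ^ 'n \<Rightarrow> bool" where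
  "diagonal_mat D \<longleftrightarrow> (\<forall>i j. i \<noteq> j \<longrightarrow> D $ i $ j = 0)"

definition cnj_mat :: "complex ^ 'n ^ 'n \<Rightarrow> complex ^ 'n ^ 'n" where
  "cnj_mat A = (\<chi> i j. cnj (A $ i $ j))"

(* The norm of complex ^ 'n is the Euclidean one; the norm that complex ^ 'n ^ 'n carries as a
   type class instance is the Frobenius norm, so it cannot be used for the operator norm. *)
definition op_norm :: "complex ^ 'n ^ 'n \<Rightarrow> real" where
  "op_norm A = onorm (\<lambda>v. A *v v)"

end

theory Submission
  imports Defs
begin

text \<open>
  On a matrix \<open>A\<close> with distinct eigenvalues the map acts as a polynomial interpolating complex
  conjugation on the spectrum. For an upper bidiagonal \<open>3 \<times> 3\<close> block with eigenvalues \<open>0\<close>, \<open>t\<close>, \<open>\<i>t\<close>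
  and superdiagonal entries \<open>s\<close>, the corner entry of the image is \<open>s\<^sup>2\<close> times the second divided
  difference of conjugation at these three points, which is \<open>(1 + \<i>) / t\<close> and blows up as \<open>t\<close>
  tends to \<open>0\<close>.
\<close>

text \<open>Upper unitriangular on the coordinates \<open>p\<close>, \<open>q\<close>,
  \<open>r\<close>, identity elsewhere. As a map on vectors it composes coordinatewise, with no sums
  over \<open>'n\<close>.\<close>

definition shear :: "'n \<Rightarrow> 'n \<Rightarrow> 'n \<Rightarrow> complex \<Rightarrow> complex \<Rightarrow> complex \<Rightarrow> complex ^ 'n \<Rightarrow> complex ^ 'n"
  where "shear p q r x y z v =
    (\<chi> i. if i = p then v $ p + x * v $ q + z * v $ r
          else if i = q then v $ q + y * v $ r else v $ i)"

lemma linear_shear: "Vector_Spaces.linear (*s) (*s) (shear p q r x y z)"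
  by unfold_locales (auto simp: shear_def vec_eq_iff algebra_simps)

text \<open>Group law of the Heisenberg group; solving for parameters \<open>0 0 0\<close> gives the
  inverse \<open>- x\<close>, \<open>- y\<close>, \<open>x * y - z\<close>.\<close>

lemma shear_shear:
  assumes "p \<noteq> q" "p \<noteq> r" "q \<noteq> r"
  shows "shear p q r x y z (shear p q r x' y' z' v) =
    shear p q r (x + x') (y + y') (z + z' + x * y') v"
  using assms by (auto simp: shear_def vec_eq_iff algebra_simps)

lemma shear_0: "shear p q r 0 0 0 v = v"
  by (auto simp: shear_def vec_eq_iff)

lemma matrix_shear_inverse:
  assumes "p \<noteq> q" "p \<noteq> r" "q \<noteq> r"
  shows "matrix (shear p q r x y z) ** matrix (shear p q r (- x) (- y) (x * y - z)) = mat 1"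
    and "matrix (shear p q r (- x) (- y) (x * y - z)) ** matrix (shear p q r x y z) = mat 1"
  unfolding matrix_eq
  by (simp_all add: matrix_vector_mul_assoc [symmetric] matrix_works [OF linear_shear]
      shear_shear [OF assms] shear_0)

lemma matrix_inv_eqI:
  fixes A B :: "'a::comm_ring_1 ^ 'n ^ 'n"
  assumes "A ** B = mat 1" "B ** A = mat 1"
  shows "matrix_inv A = B"
proof -
  have "invertible A"
    using assms by (auto simp: invertible_def)
  then have "A ** matrix_inv A = mat 1"
    unfolding invertible_def matrix_inv_def by (rule someI2_ex) blast
  then have "B ** (A ** matrix_inv A) = B"
    by simp
  then show ?thesis
    using assms(2) by (simp add: matrix_mul_assoc)
qed

lemma diagonal_matrix_vector_mult:
  fixes d :: "'n::finite \<Rightarrow> complex"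
  shows "(\<chi> i j. if i = j then d i else 0) *v v = (\<chi> i. d i * v $ i)"
  by (simp add: matrix_vector_mult_def vec_eq_iff if_distrib [of "\<lambda>c. c * _"] cong: if_cong)

lemma matrix_vector_mult_axis:
  fixes A :: "'a::semiring_1 ^ 'n ^ 'm"
  shows "(A *v axis j 1) $ i = A $ i $ j"
  by (simp add: matrix_vector_mult_def axis_def if_distrib [of "\<lambda>c. _ * c"] cong: if_cong)

lemma norm_axis: "norm (axis i c) = norm c"
  by (simp add: norm_vec_def L2_set_def axis_def if_distrib [of norm] if_distrib [of "\<lambda>c. c\<^sup>2"]
      cong: if_cong)

lemma norm_entry_le_op_norm:
  fixes A :: "complex ^ 'n ^ 'n"
  shows "norm (A $ i $ j) \<le> op_norm A"
proof -
  have "norm (A $ i $ j) = norm ((A *v axis j 1) $ i)"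
    by (simp add: matrix_vector_mult_axis)
  also have "\<dots> \<le> norm (A *v axis j 1)"
    by (rule Finite_Cartesian_Product.norm_nth_le)
  also have "\<dots> \<le> op_norm A * norm (axis j (1::complex))"
    unfolding op_norm_def by (rule onorm) (rule matrix_vector_mul_bounded_linear)
  finally show ?thesis
    by (simp add: norm_axis)
qed

lemma exists_contraction_with_large_image:
  fixes \<tau> :: "complex ^ 'n ^ 'n \<Rightarrow> complex ^ 'n ^ 'n" and m :: real
  assumes card: "CARD('n) \<ge> 3"
    and \<tau>: "\<And>(D :: complex ^ 'n ^ 'n) (T :: complex ^ 'n ^ 'n).
           diagonal_mat D \<Longrightarrow> invertible T \<Longrightarrow>
           \<tau> (T ** D ** matrix_inv T) = T ** cnj_mat D ** matrix_inv T"
    and m: "m \<ge> 1"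
  shows "\<exists>A. op_norm A \<le> 1 \<and> m \<le> op_norm (\<tau> A)"
proof -
  obtain P :: "'n set" where "card P = 3"
    using obtain_subset_with_card_n [OF card] by blast
  then obtain p q r :: 'n where pqr: "p \<noteq> q" "p \<noteq> r" "q \<noteq> r"
    by (auto simp: card_3_iff)
  \<comment> \<open>The block with \<open>t = 1 / (16 m)\<close> and \<open>s = 1 / 4\<close>; \<open>x\<close>, \<open>y\<close>, \<open>z\<close> are the coordinates of its
    eigenvectors.\<close>
  define t x y z where "t = complex_of_real (1 / (16 * m))" and "x = complex_of_real (4 * m)"
    and "y = - 2 * of_real m * (1 + \<i>)" and "z = - 8 * (of_real m)\<^sup>2 * (1 - \<i>)"
  \<comment> \<open>Conjugation is not affine on \<open>0\<close>, \<open>t\<close>,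
    \<open>\<i> * t\<close>, since these are not collinear. The value \<open>0\<close> outside the
    block makes \<open>A\<close> vanish there.\<close>
  define d where "d = (\<lambda>i. if i = q then t else if i = r then \<i> * t else 0)"
  define D :: "complex ^ 'n ^ 'n" where "D = (\<chi> i j. if i = j then d i else 0)"
  define T where "T = matrix (shear p q r x y z)"
  define S where "S = matrix (shear p q r (- x) (- y) (x * y - z))"
  define A where "A = T ** D ** S"
  have TS: "T ** S = mat 1" "S ** T = mat 1"
    unfolding T_def S_def by (rule matrix_shear_inverse [OF pqr])+
  have inv: "invertible T" "matrix_inv T = S"
    using TS by (auto simp: invertible_def intro: matrix_inv_eqI)
  have cnjD: "cnj_mat D = (\<chi> i j. if i = j then cnj (d i) else 0)"
    by (simp add: cnj_mat_def D_def vec_eq_iff)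
  have \<tau>A: "\<tau> A = T ** cnj_mat D ** S"
    using \<tau> [of D T] inv by (simp add: A_def diagonal_mat_def D_def)
  have m0: "complex_of_real m \<noteq> 0"
    using m by simp
  \<comment> \<open>The eigenvector equations of the block: \<open>(x, 1, 0)\<close> belongs to
    \<open>t\<close>, and \<open>(z, y, 1)\<close> to \<open>\<i> * t\<close>.\<close>
  have tx: "t * x = 1 / 4" and ty: "(\<i> - 1) * (t * y) = 1 / 4" and tz: "\<i> * t * z = y / 4"
    using m0 by (simp_all add: t_def x_def y_def z_def field_simps power2_eq_square)
  \<comment> \<open>Stated for any diagonal \<open>e\<close>, to serve both \<open>d\<close> and its
    conjugate.\<close>
  have conj: "(T ** (\<chi> i j. if i = j then e i else 0) ** S) *v v =
      shear p q r x y z (\<chi> i. e i * shear p q r (- x) (- y) (x * y - z) v $ i)" for e v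
    by (simp add: matrix_vector_mul_assoc [symmetric] T_def S_def
        matrix_works [OF linear_shear] diagonal_matrix_vector_mult)
  have Av: "A *v v = axis p (v $ q / 4) + axis q (t * v $ q) + axis q (v $ r / 4)
      + axis r (\<i> * t * v $ r)" for v
  proof -
    have "x * (t * (v $ q - y * v $ r)) + z * (\<i> * t * v $ r)
        = t * x * (v $ q - y * v $ r) + \<i> * t * z * v $ r"
      by (simp add: algebra_simps)
    also have "\<dots> = v $ q / 4"
      by (simp only: tx tz) (simp add: algebra_simps)
    finally have p: "x * (t * (v $ q - y * v $ r)) + z * (\<i> * t * v $ r) = v $ q / 4" .
    have "t * (v $ q - y * v $ r) + y * (\<i> * t * v $ r)
        = t * v $ q + (\<i> - 1) * (t * y) * v $ r"
      by (simp add: algebra_simps)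
    also have "\<dots> = t * v $ q + v $ r / 4"
      by (simp only: ty) simp
    finally have q: "t * (v $ q - y * v $ r) + y * (\<i> * t * v $ r) = t * v $ q + v $ r / 4" .
    show ?thesis
      using pqr p q unfolding A_def D_def conj
      by (auto simp: vec_eq_iff shear_def axis_def d_def)
  qed
  have "op_norm A \<le> 1"
    unfolding op_norm_def
  proof (rule onorm_le)
    fix v :: "complex ^ 'n"
    have t4: "norm t \<le> 1 / 4"
      using m by (simp add: t_def norm_divide field_simps)
    \<comment> \<open>One summand for each nonzero entry of the block; \<open>s = 1 / 4\<close> is
      chosen so that four such terms stay within \<open>norm v\<close>.\<close>
    have "norm (A *v v) \<le> norm (v $ q / 4) + norm (t * v $ q) + norm (v $ r / 4)
        + norm (\<i> * t * v $ r)"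
      unfolding Av by (intro norm_triangle_mono) (simp_all add: norm_axis)
    also have "\<dots> \<le> norm v / 4 + norm v / 4 + norm v / 4 + norm v / 4"
      using mult_mono [OF t4 Finite_Cartesian_Product.norm_nth_le [of v q]] mult_mono [OF t4 Finite_Cartesian_Product.norm_nth_le [of v r]]
        Finite_Cartesian_Product.norm_nth_le [of v q] Finite_Cartesian_Product.norm_nth_le [of v r]
      by (intro add_mono) (simp_all add: norm_mult norm_divide)
    finally show "norm (A *v v) \<le> 1 * norm v"
      by simp
  qed
  moreover have "m \<le> op_norm (\<tau> A)"
  proof -
    have "\<tau> A $ p $ r = (\<tau> A *v axis r 1) $ p"
      by (simp add: matrix_vector_mult_axis)
    \<comment> \<open>In \<open>A\<close> this corner is
      \<open>\<i> * t * z - t * x * y = y / 4 - y / 4 = 0\<close>. Conjugation flips only the sign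
      of the first term, so the cancellation becomes \<open>- y / 2\<close>.\<close>
    also have "\<dots> = - (\<i> * t * z) - t * x * y"
      using pqr unfolding \<tau>A cnjD conj
      by (simp add: shear_def axis_def d_def t_def algebra_simps)
    also have "\<dots> = of_real m * (1 + \<i>)"
      unfolding tz tx by (simp add: y_def)
    finally have "m \<le> norm (\<tau> A $ p $ r)"
      using complex_Re_le_cmod [of "\<tau> A $ p $ r"] by simp
    also have "\<dots> \<le> op_norm (\<tau> A)"
      by (rule norm_entry_le_op_norm)
    finally show ?thesis .
  qed
  ultimately show ?thesis
    by blast
qed

theorem mainTheorem6:
  fixes \<tau> :: "complex ^ 'n ^ 'n \<Rightarrow> complex ^ 'n ^ 'n"
  assumes "CARD('n) \<ge> 3"
    and "\<And>(D :: complex ^ 'n ^ 'n) (T :: complex ^ 'n ^ 'n).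
           diagonal_mat D \<Longrightarrow> invertible T \<Longrightarrow>
           \<tau> (T ** D ** matrix_inv T) = T ** cnj_mat D ** matrix_inv T"
  shows "(SUP A \<in> {A. op_norm A \<le> 1}. ereal (op_norm (\<tau> A))) = \<infinity>"
proof (rule SUP_PInfty)
  fix k :: nat
  \<comment> \<open>\<open>Suc k\<close> rather than \<open>k\<close>, so that the bound is at least
    \<open>1\<close> also for \<open>k = 0\<close>.\<close>
  obtain A where "op_norm A \<le> 1" "real (Suc k) \<le> op_norm (\<tau> A)"
    using exists_contraction_with_large_image [OF assms, of "real (Suc k)"] by auto
  then show "\<exists>A\<in>{A. op_norm A \<le> 1}. ereal (real k) \<le> ereal (op_norm (\<tau> A))"
    by (intro bexI [of _ A]) auto
qed

end
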